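(* Let $h:\mathbb{R}^n\to\mathbb{R}$ and $g:\mathbb{R}^m\to\mathbb{R}$ be convex, closed, proper functions such that $h$ and $g^*$ are differentiable, with $g^*$ real-valued on $\mathbb{R}^m$. Let $A\in\mathbb{R}^{n\times m}$ and $\rho>0$. Consider the following discretization, with step size $\epsilon>0$, of the ODE $\dot x_t=A\nabla g^*(A^Tp_t)-x_t$, $\dot p_t=-\nabla h(x_t)-p_t$: $$(p^{k}-p^{k-1})/\epsilon=-\nabla h(x^{k+1})-p^k-\rho(x^{k+1}-x^k)\qquad (k\ge1),$$ $$(x^{k+1}-x^k)/\epsilon=A\nabla g^*(A^Tp^{k+1})-x^k+(1/\rho)(p^{k+1}-p^k)\qquad (k\ge0).$$ If $\epsilon=1$ and the sequences $(x^k)_{k\ge0}$, $(p^k)_{k\ge0}$ in $\mathbb{R}^n$ satisfy these equations, then there is a sequence $(y^k)_{k\ge1}$ in $\mathbb{R}^m$ such that the iterates satisfy the ADMM recursion $$x^{k+1}=(\rho I+\nabla h)^{-1}(\rho Ay^k-p^k)\qquad(k\ge1),$$ $$y^{k+1}\in(\rho A^TA+\partial g)^{-1}A^T(p^k+\rho x^{k+1})\qquad(k\ge0),$$ $$p^{k+1}=p^k+\rho(x^{k+1}-Ay^{k+1})\qquad(k\ge0).$$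
   Context: $g^*(q)=\sup_y(y^Tq-g(y))$ is the convex conjugate and $\partial g$ is the convex subdifferential. For a (possibly multi-valued) operator $T$, $u\in T^{-1}(v)$ means $v\in T(u)$; thus $x=(\rho I+\nabla h)^{-1}(v)$ means $\rho x+\nabla h(x)=v$, and $y\in(\rho A^TA+\partial g)^{-1}(w)$ means $w-\rho A^TAy\in\partial g(y)$. *)

theory Defs
  imports "HOL-Analysis.Analysis"
begin

text \<open>For a real-valued function properness is automatic; it is stated for extended-real
  functions, as in convex analysis, and applied to \<open>ereal \<circ> f\<close>.\<close>

definition proper_fun :: "('a \<Rightarrow> ereal) \<Rightarrow> bool" where
  "proper_fun f \<longleftrightarrow> (\<forall>x. f x \<noteq> -\<infinity>) \<and> (\<exists>x. f x \<noteq> \<infinity>)"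

text \<open>Closed in the sense of convex analysis: the epigraph is closed.\<close>

definition closed_fun :: "('a::topological_space \<Rightarrow> real) \<Rightarrow> bool" where
  "closed_fun f \<longleftrightarrow> closed (epigraph UNIV f)"

definition convex_conjugate :: "('a::real_inner \<Rightarrow> real) \<Rightarrow> 'a \<Rightarrow> ereal" where
  "convex_conjugate f q = (SUP y. ereal (y \<bullet> q - f y))"

definition subdifferential :: "('a::real_inner \<Rightarrow> real) \<Rightarrow> 'a \<Rightarrow> 'a set" where
  "subdifferential f x = {s. \<forall>z. f x + s \<bullet> (z - x) \<le> f z}"

text \<open>Only meaningful at points of differentiability.\<close>

definition gradient :: "('a::real_inner \<Rightarrow> real) \<Rightarrow> 'a \<Rightarrow> 'a" where
  "gradient f x = (THE d. GDERIV f x :> d)"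

lemma gradient_eqI:
  assumes "GDERIV f x :> d"
  shows "gradient f x = d"
  unfolding gradient_def
proof (rule the_equality)
  show "GDERIV f x :> d" by (rule assms)
next
  fix e assume "GDERIV f x :> e"
  with assms have "(\<lambda>h. h \<bullet> d) = (\<lambda>h. h \<bullet> e)"
    unfolding gderiv_def by (rule has_derivative_unique)
  then have "\<forall>h. h \<bullet> e = h \<bullet> d" by metis
  then show "e = d" by (rule iffD1[OF vector_eq_ldot])
qed

text \<open>A multi-valued operator maps a point to a set of points; single-valued operators are
  represented by singletons.\<close>

definition op_inverse :: "('a \<Rightarrow> 'b set) \<Rightarrow> 'b \<Rightarrow> 'a set" where
  "op_inverse T v = {u. v \<in> T u}"

end

theory Submission
  imports Defs
begin

text \<open>
  Put \<open>y k = \<nabla>g\<^sup>*(A\<^sup>T p k)\<close>. With \<open>\<epsilon> = 1\<close> the \<open>x\<close>-step is then the multiplier update of ADMM solved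
  for \<open>x (k + 1)\<close>, and substituting this update for \<open>p k - p (k - 1)\<close> in the \<open>p\<close>-step cancels
  \<open>\<rho> x k\<close> and leaves \<open>\<rho> x (k + 1) + \<nabla>h(x (k + 1)) = \<rho> A (y k) - p k\<close>. By the multiplier update
  again, the \<open>y\<close>-inclusion says exactly that \<open>A\<^sup>T p (k + 1) \<in> \<partial>g(y (k + 1))\<close>.

  The analytic content is therefore the inversion of subgradients: \<open>y = \<nabla>g\<^sup>*(q)\<close> implies
  \<open>q \<in> \<partial>g(y)\<close>. This can be had without the biconjugate theorem. Finiteness of \<open>g\<^sup>*\<close> makes
  \<open>g - \<langle>\<cdot>, q\<rangle>\<close> coercive, so it has a minimiser \<open>y\<close> (lemma
  \<open>subdifferential_witness_of_finite_conjugate\<close>), that is, \<open>q \<in> \<partial>g(y)\<close>. Equality in the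
  Fenchel--Young inequality turns this into \<open>y \<in> \<partial>g\<^sup>*(q)\<close>, and at a point of differentiability
  the gradient is the only subgradient; so the minimiser is \<open>\<nabla>g\<^sup>*(q)\<close>.
\<close>

lemma Fenchel_Young:
  assumes "convex_conjugate g q = ereal c"
  shows "y \<bullet> q - g y \<le> c"
proof -
  have "ereal (y \<bullet> q - g y) \<le> convex_conjugate g q"
    unfolding convex_conjugate_def by (rule SUP_upper) simp
  with assms show ?thesis by simp
qed

lemma conjugate_eq_if_subgradient:
  assumes "convex_conjugate g q = ereal c" and "q \<in> subdifferential g y"
  shows "c = y \<bullet> q - g y"
proof (rule antisym)
  have "ereal (z \<bullet> q - g z) \<le> ereal (y \<bullet> q - g y)" for z
    using assms(2) by (auto simp: subdifferential_def inner_diff_right inner_commute algebra_simps)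
  then have "convex_conjugate g q \<le> ereal (y \<bullet> q - g y)"
    unfolding convex_conjugate_def by (intro SUP_least)
  with assms(1) show "c \<le> y \<bullet> q - g y" by simp
  show "y \<bullet> q - g y \<le> c" by (rule Fenchel_Young[OF assms(1)])
qed

text \<open>The conjugate lies above the affine function \<open>r \<mapsto> y \<bullet> r - g y\<close> and meets it at \<open>q\<close>.\<close>

lemma subdifferential_conjugate:
  assumes conj: "\<And>r. convex_conjugate g r = ereal (gs r)" and q: "q \<in> subdifferential g y"
  shows "y \<in> subdifferential gs q"
  unfolding subdifferential_def
proof (intro CollectI allI)
  fix r
  have "gs q = y \<bullet> q - g y" by (rule conjugate_eq_if_subgradient[OF conj q])
  moreover have "y \<bullet> r - g y \<le> gs r" by (rule Fenchel_Young[OF conj])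
  ultimately show "gs q + y \<bullet> (r - q) \<le> gs r" by (simp add: inner_diff_right)
qed

text \<open>Subtracting the linear function of the subgradient leaves a function with a global minimum
  at the given point, whose derivative vanishes there.\<close>

lemma gradient_unique_subgradient:
  fixes f :: "'a::real_inner \<Rightarrow> real"
  assumes "f differentiable (at q)" and s: "s \<in> subdifferential f q"
  shows "gradient f q = s"
proof -
  from assms(1) obtain D where D: "(f has_derivative D) (at q)"
    unfolding differentiable_def by blast
  have "((\<lambda>r. f r - r \<bullet> s) has_derivative (\<lambda>d. D d - d \<bullet> s)) (at q)"
    by (intro derivative_intros D)
  moreover have "f q - q \<bullet> s \<le> f r - r \<bullet> s" for r
    using s by (auto simp: subdifferential_def inner_diff_right inner_commute algebra_simps)
  ultimately have "(\<lambda>d. D d - d \<bullet> s) = (\<lambda>d. 0)"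
    by (intro differential_zero_maxmin[of q UNIV]) auto
  then have "D = (\<lambda>d. d \<bullet> s)" by (metis eq_iff_diff_eq_0)
  with D have "GDERIV f q :> s" by (simp add: gderiv_def)
  then show ?thesis by (rule gradient_eqI)
qed

text \<open>The Fenchel--Young inequality at the points \<open>q \<plusminus> b\<close>, for \<open>b\<close> in the basis, bounds every
  coordinate of a point in terms of the value of \<open>g - \<langle>\<cdot>, q\<rangle>\<close> there; finiteness of the conjugate
  at these finitely many points thus bounds the sublevel sets.\<close>

lemma bounded_sublevel_of_finite_conjugate:
  fixes g :: "'a::euclidean_space \<Rightarrow> real"
  assumes conj: "\<And>r. convex_conjugate g r = ereal (gs r)"
  shows "bounded {y. g y - y \<bullet> q \<le> c}"
proof -
  define C where "C b = max (gs (q + b)) (gs (q - b))" for b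
  have "norm y \<le> (\<Sum>b\<in>Basis. c + C b)" if "g y - y \<bullet> q \<le> c" for y
  proof -
    have "\<bar>y \<bullet> b\<bar> \<le> c + C b" for b
      using Fenchel_Young[OF conj, of y "q + b"] Fenchel_Young[OF conj, of y "q - b"] that
      unfolding C_def inner_add_right inner_diff_right by linarith
    then have "(\<Sum>b\<in>Basis. \<bar>y \<bullet> b\<bar>) \<le> (\<Sum>b\<in>Basis. c + C b)" by (intro sum_mono)
    with norm_le_l1[of y] show ?thesis by linarith
  qed
  then show ?thesis by (intro boundedI) blast
qed

text \<open>A minimiser of \<open>g - \<langle>\<cdot>, q\<rangle>\<close> is exactly a point at which \<open>q\<close> is a subgradient. Convexity on the
  whole space enters through continuity, which makes the bounded sublevel sets compact.\<close>

lemma subdifferential_witness_of_finite_conjugate: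
  fixes g :: "'a::euclidean_space \<Rightarrow> real"
  assumes "convex_on UNIV g" and conj: "\<And>r. convex_conjugate g r = ereal (gs r)"
  obtains y where "q \<in> subdifferential g y"
proof -
  define f where "f y = g y - y \<bullet> q" for y
  have cont: "continuous_on UNIV f"
    unfolding f_def using convex_on_continuous[OF open_UNIV assms(1)]
    by (intro continuous_intros)
  define S where "S = {y. f y \<le> f 0}"
  have "closed S"
    unfolding S_def using cont by (intro closed_Collect_le continuous_intros)
  moreover have "bounded S"
    using bounded_sublevel_of_finite_conjugate[OF conj, of q "f 0"]
    by (simp add: S_def f_def)
  ultimately have "compact S" by (simp add: compact_eq_bounded_closed)
  moreover have "0 \<in> S" by (simp add: S_def)
  ultimately obtain y where y: "y \<in> S" "\<And>z. z \<in> S \<Longrightarrow> f y \<le> f z"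
    using continuous_attains_inf[of S f] continuous_on_subset[OF cont] by blast
  have "f y \<le> f z" for z
    using y(2)[of z] y(1) by (cases "z \<in> S") (auto simp: S_def)
  then have "q \<in> subdifferential g y"
    by (auto simp: subdifferential_def f_def inner_diff_right inner_commute algebra_simps)
  then show thesis by (rule that)
qed

theorem subgradient_at_gradient_conjugate:
  fixes g :: "'a::euclidean_space \<Rightarrow> real"
  assumes "convex_on UNIV g" and conj: "\<And>r. convex_conjugate g r = ereal (gs r)"
    and "gs differentiable (at q)"
  shows "q \<in> subdifferential g (gradient gs q)"
proof -
  obtain y where y: "q \<in> subdifferential g y"
    using subdifferential_witness_of_finite_conjugate[OF assms(1) conj] .
  have "gradient gs q = y"
    by (rule gradient_unique_subgradient[OF assms(3) subdifferential_conjugate[OF conj y]])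
  with y show ?thesis by simp
qed

theorem mainTheorem4:
  fixes h :: "real ^ 'n \<Rightarrow> real" and g :: "real ^ 'm \<Rightarrow> real"
    and gstar :: "real ^ 'm \<Rightarrow> real"
    and A :: "real ^ 'm ^ 'n" and \<rho> \<epsilon> :: real
    and x p :: "nat \<Rightarrow> real ^ 'n"
  assumes h: "convex_on UNIV h" "closed_fun h" "proper_fun (\<lambda>u. ereal (h u))"
    and g: "convex_on UNIV g" "closed_fun g" "proper_fun (\<lambda>y. ereal (g y))"
    and gstar_real: "\<And>q. convex_conjugate g q = ereal (gstar q)"
    and h_diff: "\<And>u. h differentiable (at u)"
    and gstar_diff: "\<And>q. gstar differentiable (at q)"
    and rho: "\<rho> > 0"
    and eps: "\<epsilon> > 0" "\<epsilon> = 1"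
    and p_step: "\<And>k. k \<ge> 1 \<Longrightarrow>
      (p k - p (k - 1)) /\<^sub>R \<epsilon> =
        - gradient h (x (k + 1)) - p k - \<rho> *\<^sub>R (x (k + 1) - x k)"
    and x_step: "\<And>k.
      (x (k + 1) - x k) /\<^sub>R \<epsilon> =
        A *v gradient gstar (transpose A *v p (k + 1)) - x k
          + (1 / \<rho>) *\<^sub>R (p (k + 1) - p k)"
  shows "\<exists>y :: nat \<Rightarrow> real ^ 'm.
    (\<forall>k\<ge>1. x (k + 1) \<in> op_inverse
        (\<lambda>u. {\<rho> *\<^sub>R u + gradient h u})
        (\<rho> *\<^sub>R (A *v y k) - p k)) \<and>
    (\<forall>k. y (k + 1) \<in> op_inverse
        (\<lambda>z. {\<rho> *\<^sub>R ((transpose A ** A) *v z) + s | s. s \<in> subdifferential g z})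
        (transpose A *v (p k + \<rho> *\<^sub>R x (k + 1)))) \<and>
    (\<forall>k. p (k + 1) = p k + \<rho> *\<^sub>R (x (k + 1) - A *v y (k + 1)))"
proof -
  define y where "y k = gradient gstar (transpose A *v p k)" for k
  have p_update: "p (k + 1) = p k + \<rho> *\<^sub>R (x (k + 1) - A *v y (k + 1))" for k
  proof -
    have "x (k + 1) - A *v y (k + 1) = (1 / \<rho>) *\<^sub>R (p (k + 1) - p k)"
      using x_step[of k] eps by (simp add: y_def algebra_simps)
    with rho show ?thesis by simp
  qed
  have x_update: "\<rho> *\<^sub>R x (k + 1) + gradient h (x (k + 1)) = \<rho> *\<^sub>R (A *v y k) - p k"
    if "k \<ge> 1" for k
  proof -
    have "p k - p (k - 1) = \<rho> *\<^sub>R (x k - A *v y k)"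
      using p_update[of "k - 1"] that by simp
    moreover have "p k - p (k - 1) =
        - gradient h (x (k + 1)) - p k - \<rho> *\<^sub>R (x (k + 1) - x k)"
      using p_step[OF that] eps by simp
    ultimately have "\<rho> *\<^sub>R (x k - A *v y k) =
        - gradient h (x (k + 1)) - p k - \<rho> *\<^sub>R (x (k + 1) - x k)"
      by (rule trans[OF sym])
    then show ?thesis by (simp add: algebra_simps)
  qed
  have y_update: "transpose A *v (p k + \<rho> *\<^sub>R x (k + 1)) =
      \<rho> *\<^sub>R ((transpose A ** A) *v y (k + 1)) + transpose A *v p (k + 1)" for k
    unfolding p_update[of k]
    by (simp add: matrix_vector_right_distrib matrix_vector_mult_diff_distrib
        matrix_vector_mult_scaleR matrix_vector_mul_assoc[symmetric] algebra_simps)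
  have "transpose A *v p k \<in> subdifferential g (y k)" for k
    unfolding y_def
    by (rule subgradient_at_gradient_conjugate[OF g(1) gstar_real gstar_diff])
  with x_update y_update p_update show ?thesis
    unfolding op_inverse_def by (intro exI[of _ y]) fastforce
qed

end
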